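(* Let $i\in\mathbb{N}_0$ and let $\alpha,\beta,\gamma\in\mathbb{C}$. Then $$F^{2:0;1}_{1:0;1}\left[\begin{matrix}\alpha,\ \gamma: & -\,; & \alpha-\beta-\gamma+1+i\,;\\ \beta: & -\,; & \alpha-\gamma+1+i\,;\end{matrix}\ -1,\ 1\right] =\frac{2^{i-2\gamma}\,\Gamma(1+\alpha-\gamma+i)\,\Gamma(\gamma-i)}{\Gamma(\gamma)\,\Gamma(1+\alpha-2\gamma+i)}\sum_{r=0}^{i}(-1)^r\binom{i}{r}\frac{\Gamma\!\left(\frac{\alpha+i+r+1}{2}-\gamma\right)}{\Gamma\!\left(\frac{\alpha-i+r+1}{2}\right)}$$ and $$F^{2:0;1}_{1:0;1}\left[\begin{matrix}\alpha,\ \gamma: & -\,; & \alpha-\beta-\gamma+1-i\,;\\ \beta: & -\,; & \alpha-\gamma+1-i\,;\end{matrix}\ -1,\ 1\right] =\frac{2^{-i-2\gamma}\,\Gamma(1+\alpha-\gamma-i)}{\Gamma(1+\alpha-2\gamma-i)}\sum_{r=0}^{i}\binom{i}{r}\frac{\Gamma\!\left(\frac{\alpha-i+r+1}{2}-\gamma\right)}{\Gamma\!\left(\frac{\alpha-i+r+1}{2}\right)}.$$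
   Context: For $\lambda\in\mathbb{C}$ and $n\in\mathbb{N}_0$, $(\lambda)_0=1$ and $(\lambda)_n=\lambda(\lambda+1)\cdots(\lambda+n-1)$; $\Gamma$ is Euler's Gamma function and $\binom{i}{r}$ the binomial coefficient. The (generalized) Kampé de Fériet function is defined by $$F^{H:A;B}_{G:C;D}\left[\begin{matrix}(h_H): & (a_A)\,; & (b_B)\,;\\ (g_G): & (c_C)\,; & (d_D)\,;\end{matrix}\ x,\ y\right]=\sum_{m=0}^\infty\sum_{n=0}^\infty\frac{\prod_{j=1}^H(h_j)_{m+n}\prod_{j=1}^A(a_j)_m\prod_{j=1}^B(b_j)_n}{\prod_{j=1}^G(g_j)_{m+n}\prod_{j=1}^C(c_j)_m\prod_{j=1}^D(d_j)_n}\frac{x^m}{m!}\frac{y^n}{n!},$$ where a dash "$-$" denotes an empty list of parameters (empty products equal $1$). Parameters are tacitly assumed to be such that the double series converges, no denominator parameter is a non-positive integer, and all Gamma values appearing are finite. *)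

theory Defs
  imports "HOL-Analysis.Analysis"
begin

definition kdf_term ::
  "complex list \<Rightarrow> complex list \<Rightarrow> complex list \<Rightarrow> complex list \<Rightarrow> complex list \<Rightarrow> complex list
   \<Rightarrow> complex \<Rightarrow> complex \<Rightarrow> nat \<Rightarrow> nat \<Rightarrow> complex" where
  "kdf_term hs as bs gs cs ds x y m n =
     (prod_list (map (\<lambda>h. pochhammer h (m + n)) hs) *
      prod_list (map (\<lambda>a. pochhammer a m) as) *
      prod_list (map (\<lambda>b. pochhammer b n) bs)) /
     (prod_list (map (\<lambda>g. pochhammer g (m + n)) gs) *
      prod_list (map (\<lambda>c. pochhammer c m) cs) *
      prod_list (map (\<lambda>d. pochhammer d n) ds)) *
     (x ^ m / of_nat (fact m)) * (y ^ n / of_nat (fact n))"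

definition kdf_diag ::
  "complex list \<Rightarrow> complex list \<Rightarrow> complex list \<Rightarrow> complex list \<Rightarrow> complex list \<Rightarrow> complex list
   \<Rightarrow> complex \<Rightarrow> complex \<Rightarrow> nat \<Rightarrow> complex" where
  "kdf_diag hs as bs gs cs ds x y N = (\<Sum>m\<le>N. kdf_term hs as bs gs cs ds x y m (N - m))"

definition kdf_converges ::
  "complex list \<Rightarrow> complex list \<Rightarrow> complex list \<Rightarrow> complex list \<Rightarrow> complex list \<Rightarrow> complex list
   \<Rightarrow> complex \<Rightarrow> complex \<Rightarrow> bool" where
  "kdf_converges hs as bs gs cs ds x y \<longleftrightarrow> summable (kdf_diag hs as bs gs cs ds x y)"

definition KdF ::
  "complex list \<Rightarrow> complex list \<Rightarrow> complex list \<Rightarrow> complex list \<Rightarrow> complex list \<Rightarrow> complex list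
   \<Rightarrow> complex \<Rightarrow> complex \<Rightarrow> complex" where
  "KdF hs as bs gs cs ds x y = (\<Sum>N. kdf_diag hs as bs gs cs ds x y N)"

end

theory Submission
  imports Defs
begin

text \<open>
  Summing the double series along its diagonals, the Chu--Vandermonde identity eliminates
  \<open>\<beta>\<close> and leaves the single series \<open>2F1(\<alpha>, \<gamma>; 1 + \<alpha> - \<gamma> \<plusminus> i; -1)\<close>. Contiguous relations, which at
  argument \<open>-1\<close> are telescoping sums, lower \<open>i\<close> by one and produce the binomial sums through
  Pascal's rule; they reduce everything to Kummer's theorem, the case \<open>i = 0\<close>.
  For Kummer's theorem, a step from \<open>b\<close> to \<open>b - 1\<close> makes the series absolutely convergent, and
  steps from \<open>a\<close> to \<open>a + 2\<close> then express its value as a limit \<open>a \<longrightarrow> \<infinity>\<close>, which is known up to a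
  factor depending on \<open>b\<close> only; that factor is read off at \<open>a = 0\<close>.
  The series may converge only conditionally. The reduction steps inherit convergence, because
  they divide the terms by factors linear in \<open>n\<close> and partial summation applies.
\<close>

subsection \<open>Contiguous relations at argument \<open>-1\<close>\<close>

text \<open>
  Dividing by \<open>\<Gamma>(c)\<close> keeps the contiguous relations valid when \<open>c\<close> is a non-positive integer,
  which does occur on the way down to \<open>i = 0\<close>.
\<close>

definition hyp_term :: "complex \<Rightarrow> complex \<Rightarrow> complex \<Rightarrow> nat \<Rightarrow> complex" where
  "hyp_term a b c n =
     (-1) ^ n * (pochhammer a n * pochhammer b n / fact n) * rGamma (c + of_nat n)"

definition hyp_sum :: "complex \<Rightarrow> complex \<Rightarrow> complex \<Rightarrow> complex" where
  "hyp_sum a b c = (\<Sum>n. hyp_term a b c n)"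

lemma hyp_term_0 [simp]: "hyp_term a b c 0 = rGamma c"
  by (simp add: hyp_term_def)

lemma hyp_term_commute: "hyp_term a b c = hyp_term b a c"
  by (simp add: hyp_term_def mult.commute fun_eq_iff)

lemma rGamma_add_of_nat: "rGamma (c + of_nat n) = (c + of_nat n) * rGamma (c + 1 + of_nat n)"
  for c :: complex
  using rGamma_plus1[of "c + of_nat n"] by (simp add: add_ac)

section \<open>Partial summation, telescoping, and convergence under unit shifts of the
  parameters\<close>

text \<open>Abel summation. With bounded partial sums F and u n = 1/(s + n), the term f n u n splits
  into F (n+1) (u n - u (n+1)), which is O(1/n^2), and a telescoping difference. Relating f and g by
  a product instead of a quotient leaves g free at an index where s + n = 0; one term does not
  affect convergence.\<close>

lemma summable_quotient_linear:
  fixes f g :: "nat \<Rightarrow> complex"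
  assumes f: "summable f" and g: "\<And>n. (s + of_nat n) * g n = f n"
  shows "summable g"
proof -
  define F where "F n = sum f {..<n}" for n
  define u where "u n = inverse (s + of_nat n)" for n :: nat
  have F_lim: "F \<longlonglongrightarrow> suminf f"
    unfolding F_def using f by (rule summable_LIMSEQ)
  then obtain B where B: "\<And>n. norm (F n) \<le> B" "B > 0"
    using convergent_imp_Bseq[of F] by (auto simp: convergent_def elim!: BseqE)
  have u_lim: "u \<longlonglongrightarrow> 0"
    unfolding u_def
    by (intro tendsto_inverse_0[THEN filterlim_compose] tendsto_add_filterlim_at_infinity[of _ s]
         tendsto_const tendsto_of_nat)
  \<comment> \<open>The extra 2 forces n > 0, so that \<open>big\<close> also excludes s + n =
    0.\<close>
  have ev: "\<forall>\<^sub>F n in sequentially. real n \<ge> 2 * norm s + 2"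
    by (rule eventually_compose_filterlim[OF eventually_ge_at_top filterlim_real_sequentially])
  have big: "norm (s + of_nat n) \<ge> real n / 2" if "real n \<ge> 2 * norm s" for n
    using norm_diff_ineq[of "of_nat n" s] that by (simp add: add.commute)
  have ev': "\<forall>\<^sub>F n in sequentially. norm (F (Suc n) * (u n - u (Suc n))) \<le> 4 * B * inverse (real n ^ 2)"
    using ev
  proof eventually_elim
    case (elim n)
    have n: "real n > 0" using elim norm_ge_zero[of s] by linarith
    have b: "norm (s + of_nat n) \<ge> real n / 2" "norm (s + of_nat (Suc n)) \<ge> real n / 2"
      using big[of n] big[of "Suc n"] elim by simp_all
    have nz: "s + of_nat n \<noteq> 0" "s + of_nat (Suc n) \<noteq> 0"
      using b n by auto
    have "u n - u (Suc n) = inverse ((s + of_nat n) * (s + of_nat (Suc n)))"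
      unfolding u_def using nz by (simp add: divide_simps)
    then have "norm (u n - u (Suc n)) = inverse (norm (s + of_nat n) * norm (s + of_nat (Suc n)))"
      by (simp add: norm_inverse norm_mult)
    also have "\<dots> \<le> inverse (real n / 2 * (real n / 2))"
      using n b by (intro le_imp_inverse_le mult_mono) auto
    also have "\<dots> = 4 * inverse (real n ^ 2)"
      using n by (simp add: field_simps power2_eq_square)
    finally have "norm (u n - u (Suc n)) \<le> 4 * inverse (real n ^ 2)" .
    from mult_mono[OF B(1)[of "Suc n"] this] B(2) show ?case
      by (simp add: norm_mult mult_ac)
  qed
  have "summable (\<lambda>n. F (Suc n) * (u n - u (Suc n)))"
    by (rule summable_comparison_test_ev[OF ev'])
       (intro summable_mult inverse_power_summable, simp)
  moreover have "summable (\<lambda>n. F (Suc n) * u (Suc n) - F n * u n)"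
    using telescope_summable[OF tendsto_mult[OF F_lim u_lim]] .
  ultimately have "summable (\<lambda>n. F (Suc n) * (u n - u (Suc n)) + (F (Suc n) * u (Suc n) - F n * u n))"
    by (rule summable_add)
  also have "(\<lambda>n. F (Suc n) * (u n - u (Suc n)) + (F (Suc n) * u (Suc n) - F n * u n)) = (\<lambda>n. f n * u n)"
    by (rule ext) (simp add: F_def algebra_simps)
  finally have "summable (\<lambda>n. f n * u n)" .
  moreover have "\<forall>\<^sub>F n in sequentially. f n * u n = g n"
    using ev
  proof eventually_elim
    case (elim n)
    have "s + of_nat n \<noteq> 0"
      using big[of n] elim norm_ge_zero[of s] by auto
    then show ?case using g[of n] by (simp add: u_def field_simps)
  qed
  ultimately show ?thesis
    using summable_cong[of "\<lambda>n. f n * u n" g] by simp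
qed

text \<open>The common frame of the contiguous relations: f is the difference of the two sides, and
  the certificate V n is the sum of f over all indices up to and including n. Each V below is a
  fixed linear combination of terms of convergent series, hence tends to 0.\<close>

lemma sums_0_telescope:
  fixes f V :: "nat \<Rightarrow> complex"
  assumes "f 0 = V 0" "\<And>n. f (Suc n) = V (Suc n) - V n" "V \<longlonglongrightarrow> 0"
  shows "f sums 0"
proof -
  have "(\<Sum>k<Suc n. f k) = V n" for n
    by (induction n) (simp_all add: assms)
  then have "(\<lambda>n. \<Sum>k<Suc n. f k) \<longlonglongrightarrow> 0"
    using assms(3) by simp
  then show ?thesis
    unfolding sums_def by (rule LIMSEQ_imp_Suc)
qed

text \<open>Since (a-1+n) (a-1)_n = (a-1) (a)_n, the new term is a constant multiple of the old one
  divided by a factor linear in n.\<close>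

lemma summable_hyp_term_lower_left:
  assumes "summable (hyp_term a b c)"
  shows "summable (hyp_term (a - 1) b c)"
proof (rule summable_quotient_linear)
  show "summable (\<lambda>n. (a - 1) * hyp_term a b c n)"
    using assms by (rule summable_mult)
  fix n
  have p: "(a - 1 + of_nat n) * pochhammer (a - 1) n = (a - 1) * pochhammer a n"
    using pochhammer_rec[of "a - 1" n] pochhammer_rec'[of "a - 1" n] by simp
  have "(a - 1 + of_nat n) * hyp_term (a - 1) b c n =
     ((a - 1 + of_nat n) * pochhammer (a - 1) n) *
       ((-1) ^ n * pochhammer b n / fact n * rGamma (c + of_nat n))"
    by (simp add: hyp_term_def)
  also have "\<dots> = (a - 1) * hyp_term a b c n"
    by (simp add: p hyp_term_def)
  finally show "(a - 1 + of_nat n) * hyp_term (a - 1) b c n = (a - 1) * hyp_term a b c n" .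
qed

lemma summable_hyp_term_lower_right:
  assumes "summable (hyp_term a b c)"
  shows "summable (hyp_term a (b - 1) c)"
  using summable_hyp_term_lower_left[of b a c] assms
  unfolding hyp_term_commute[of a] .

lemma summable_hyp_term_raise:
  assumes "summable (hyp_term a b c)"
  shows "summable (hyp_term a b (c + 1))"
proof (rule summable_quotient_linear[OF assms])
  show "(c + of_nat n) * hyp_term a b (c + 1) n = hyp_term a b c n" for n
    unfolding hyp_term_def rGamma_add_of_nat[of c] by simp
qed

text \<open>Here the ratio of new to old term is (a-1)(c-1+n)/(a-1+n), which does not decay. Writing
  (c-1+n)/(a-1+n) = 1 + (c-a)/(a-1+n) separates a multiple of the given series from a remainder
  \<open>g\<close> with a linear denominator.\<close>

lemma summable_hyp_term_lower_left_lower: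
  assumes "summable (hyp_term a b c)"
  shows "summable (hyp_term (a - 1) b (c - 1))"
proof -
  define g where "g n = hyp_term (a - 1) b (c - 1) n - (a - 1) * hyp_term a b c n" for n
  have "summable g"
  proof (rule summable_quotient_linear)
    show "summable (\<lambda>n. (a - 1) * (c - a) * hyp_term a b c n)"
      using assms by (rule summable_mult)
    fix n
    have p: "(a - 1 + of_nat n) * pochhammer (a - 1) n = (a - 1) * pochhammer a n"
      using pochhammer_rec[of "a - 1" n] pochhammer_rec'[of "a - 1" n] by simp
    have "(a - 1 + of_nat n) * hyp_term (a - 1) b (c - 1) n =
       ((a - 1 + of_nat n) * pochhammer (a - 1) n) * ((-1) ^ n * pochhammer b n / fact n *
         ((c - 1 + of_nat n) * rGamma (c + of_nat n)))"
      unfolding hyp_term_def rGamma_add_of_nat[of "c - 1"] by simp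
    also have "\<dots> = (a - 1) * (c - 1 + of_nat n) * hyp_term a b c n"
      unfolding p hyp_term_def by simp
    finally show "(a - 1 + of_nat n) * g n = (a - 1) * (c - a) * hyp_term a b c n"
      unfolding g_def by (simp add: algebra_simps)
  qed
  from summable_add[OF this summable_mult[OF assms, of "a - 1"]] show ?thesis
    by (simp add: g_def)
qed

section \<open>The two three-term relations that drive the induction on i\<close>

text \<open>Both series on the right have 1 + a - b - c smaller by one than the series on the left.
  Thus a deficit of i + 1 against Kummer's condition c = 1 + a - b is reduced to a deficit of
  i.\<close>

lemma hyp_sum_contiguous_minus:
  assumes "summable (hyp_term a b c)"
  shows "2 * hyp_sum a b c = hyp_sum (a - 1) b c + (c - b) * hyp_sum a b (c + 1)"
proof -
  note s = assms summable_hyp_term_lower_left[OF assms] summable_hyp_term_raise[OF assms]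
  define f where "f n = 2 * hyp_term a b c n - hyp_term (a - 1) b c n - (c - b) * hyp_term a b (c + 1) n" for n
  define V where "V n = hyp_term a b c n - (c - b) * hyp_term a b (c + 1) n" for n
  have "f sums 0"
  proof (rule sums_0_telescope)
    show "f 0 = V 0" by (simp add: f_def V_def)
    have "V \<longlonglongrightarrow> 0 - (c - b) * 0"
      unfolding V_def by (intro tendsto_intros summable_LIMSEQ_zero s)
    then show "V \<longlonglongrightarrow> 0" by simp
    fix n
    \<comment> \<open>The reciprocal Gamma value with the largest argument: the others are
      polynomial multiples of it, also at poles of Gamma, and the claim becomes a polynomial
      identity.\<close>
    define g where "g = rGamma (c + 1 + 1 + of_nat n)"
    have g: "rGamma (c + 1 + of_nat n) = (c + 1 + of_nat n) * g"
            "rGamma (c + of_nat n) = (c + of_nat n) * ((c + 1 + of_nat n) * g)"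
      using rGamma_add_of_nat[of c n] rGamma_add_of_nat[of "c + 1" n] by (simp_all add: g_def)
    have g': "rGamma (c + of_nat (Suc n)) = (c + 1 + of_nat n) * g" "rGamma (c + 1 + of_nat (Suc n)) = g"
      using g by (simp_all add: g_def add_ac)
    have p: "pochhammer (a - 1) (Suc n) = (a - 1) * pochhammer a n"
      using pochhammer_rec[of "a - 1" n] by simp
    have nz: "1 + of_nat n \<noteq> (0::complex)"
      by (metis of_nat_Suc of_nat_neq_0)
    show "f (Suc n) = V (Suc n) - V n"
      unfolding f_def V_def hyp_term_def g g' p unfolding pochhammer_rec' fact_Suc using nz
      by (simp add: divide_simps) (simp add: algebra_simps)?
  qed
  moreover have "f sums (2 * hyp_sum a b c - hyp_sum (a - 1) b c - (c - b) * hyp_sum a b (c + 1))"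
    unfolding f_def hyp_sum_def by (intro sums_diff sums_mult summable_sums s)
  ultimately show ?thesis
    using sums_unique2 by (fastforce simp: algebra_simps)
qed

text \<open>The counterpart for c above 1 + a - b: both series on the right have c - (1 + a - b)
  smaller by one. The factor b - 1 on the left turns 1/Gamma(b-1) into 1/Gamma(b) at each step and
  so builds up the quotient Gamma(b-i)/Gamma(b).\<close>

lemma hyp_sum_contiguous_plus:
  assumes "summable (hyp_term a b c)"
  shows "2 * (b - 1) * hyp_sum a b c =
    hyp_sum (a - 1) (b - 1) (c - 1) - (c - b) * hyp_sum a (b - 1) c"
proof -
  note s = assms summable_hyp_term_lower_right[OF assms]
    summable_hyp_term_lower_left_lower[OF summable_hyp_term_lower_right[OF assms]]
  define f where "f n = 2 * (b - 1) * hyp_term a b c n - hyp_term (a - 1) (b - 1) (c - 1) n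
     + (c - b) * hyp_term a (b - 1) c n" for n
  define V where "V n = (b - 1) * hyp_term a b c n" for n
  have "f sums 0"
  proof (rule sums_0_telescope)
    have "rGamma (c - 1) = (c - 1) * rGamma c"
      using rGamma_plus1[of "c - 1"] by simp
    then show "f 0 = V 0" by (simp add: f_def V_def algebra_simps)
    have "V \<longlonglongrightarrow> (b - 1) * 0"
      unfolding V_def by (intro tendsto_intros summable_LIMSEQ_zero s)
    then show "V \<longlonglongrightarrow> 0" by simp
    fix n
    define g where "g = rGamma (c + 1 + of_nat n)"
    have g: "rGamma (c + of_nat n) = (c + of_nat n) * g"
      using rGamma_add_of_nat[of c n] by (simp_all add: g_def)
    have g': "rGamma (c + of_nat (Suc n)) = g" "rGamma (c - 1 + of_nat (Suc n)) = (c + of_nat n) * g"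
      using g by (simp_all add: g_def add_ac)
    have p: "pochhammer (a - 1) (Suc n) = (a - 1) * pochhammer a n" for a :: complex
      using pochhammer_rec[of "a - 1" n] by simp
    have nz: "1 + of_nat n \<noteq> (0::complex)"
      by (metis of_nat_Suc of_nat_neq_0)
    show "f (Suc n) = V (Suc n) - V n"
      unfolding f_def V_def hyp_term_def g g' p unfolding pochhammer_rec' fact_Suc using nz
      by (simp add: divide_simps) (simp add: algebra_simps)?
  qed
  moreover have "f sums (2 * (b - 1) * hyp_sum a b c - hyp_sum (a - 1) (b - 1) (c - 1)
     + (c - b) * hyp_sum a (b - 1) c)"
    unfolding f_def hyp_sum_def by (intro sums_diff sums_add sums_mult summable_sums s)
  ultimately show ?thesis
    using sums_unique2 by (fastforce simp: algebra_simps)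
qed

subsection \<open>Kummer's theorem\<close>

text \<open>Lowering b and raising c by one preserves c = 1 + a - b. Repeated use moves b into the
  half plane Re b \<le> -1, where convergence is absolute.\<close>

lemma kummer_lower_right:
  assumes "summable (hyp_term a b (1 + a - b))"
  shows "2 * hyp_sum a b (1 + a - b) = (2 + a - 2 * b) * hyp_sum a (b - 1) (2 + a - b)"
proof -
  define c where "c = 1 + a - b"
  have a: "a = c + b - 1" by (simp add: c_def)
  have s: "summable (hyp_term a b c)" "summable (hyp_term a b (c + 1))"
     "summable (hyp_term a (b - 1) (c + 1))"
    unfolding c_def
    by (intro assms summable_hyp_term_raise summable_hyp_term_lower_right)+
  define f where "f n = 2 * hyp_term a b c n - (2 + a - 2 * b) * hyp_term a (b - 1) (c + 1) n" for n
  define V where "V n = hyp_term a b c n + (a - c) * hyp_term a b (c + 1) n" for n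
  have "f sums 0"
  proof (rule sums_0_telescope)
    have r: "rGamma c = c * rGamma (c + 1)"
      using rGamma_plus1[of c] by simp
    show "f 0 = V 0"
      unfolding f_def V_def hyp_term_0 r unfolding a by algebra
    have "V \<longlonglongrightarrow> 0 + (a - c) * 0"
      unfolding V_def by (intro tendsto_intros summable_LIMSEQ_zero s)
    then show "V \<longlonglongrightarrow> 0" by simp
    fix n
    define g where "g = rGamma (c + 1 + 1 + of_nat n)"
    have g: "rGamma (c + 1 + of_nat n) = (c + 1 + of_nat n) * g"
            "rGamma (c + of_nat n) = (c + of_nat n) * ((c + 1 + of_nat n) * g)"
      using rGamma_add_of_nat[of c n] rGamma_add_of_nat[of "c + 1" n] by (simp_all add: g_def)
    have g': "rGamma (c + of_nat (Suc n)) = (c + 1 + of_nat n) * g" "rGamma (c + 1 + of_nat (Suc n)) = g"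
      using g by (simp_all add: g_def add_ac)
    have p: "pochhammer (b - 1) (Suc n) = (b - 1) * pochhammer b n"
      using pochhammer_rec[of "b - 1" n] by simp
    define N where "N = complex_of_nat n"
    \<comment> \<open>All five terms are polynomial multiples of \<open>w\<close>; once a is
      replaced by c + b - 1, the telescoping relation is a polynomial identity in b, c and
      N.\<close>
    define w where "w = (-1) ^ n * pochhammer a n * pochhammer b n / fact n * g / (N + 1)"
    have nz: "N + 1 \<noteq> 0"
      unfolding N_def by (metis of_nat_Suc of_nat_neq_0 add.commute)
    have t: "hyp_term a b c (Suc n) = - ((a + N) * (b + N) * (c + 1 + N) * w)"
        "hyp_term a (b - 1) (c + 1) (Suc n) = - ((a + N) * (b - 1) * w)"
        "hyp_term a b (c + 1) (Suc n) = - ((a + N) * (b + N) * w)"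
        "hyp_term a b c n = (c + N) * (c + 1 + N) * (N + 1) * w"
        "hyp_term a b (c + 1) n = (c + 1 + N) * (N + 1) * w"
      unfolding hyp_term_def g g' p w_def unfolding pochhammer_rec' fact_Suc using nz
      by (simp_all add: N_def add_ac mult_ac)
    show "f (Suc n) = V (Suc n) - V n"
      unfolding f_def V_def t unfolding a by algebra
  qed
  moreover have "f sums (2 * hyp_sum a b c - (2 + a - 2 * b) * hyp_sum a (b - 1) (c + 1))"
    unfolding f_def hyp_sum_def by (intro sums_diff sums_add sums_mult summable_sums s)
  ultimately have "2 * hyp_sum a b c - (2 + a - 2 * b) * hyp_sum a (b - 1) (c + 1) = 0"
    using sums_unique2 by blast
  then show ?thesis by (simp add: c_def algebra_simps)
qed

text \<open>The closed form depends on a through 2^(-a) and Gamma values at arguments with a/2, so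
  the natural step is 2. The factor equals 4 ((a+1)/2) (1+a/2-b), the quotient of the expected
  values at a and a + 2. The certificate \<open>V\<close> uses series at a + 1, hence the assumption
  for every a.\<close>

lemma kummer_raise_left:
  assumes "\<And>a. summable (hyp_term a b (1 + a - b))"
  shows "hyp_sum a b (1 + a - b) = (a + 1) * (a + 2 - 2 * b) * hyp_sum (a + 2) b (1 + (a + 2) - b)"
proof -
  define c where "c = 1 + a - b"
  have a: "a = c + b - 1" by (simp add: c_def)
  have s: "summable (hyp_term a b c)" "summable (hyp_term (a + 1) b (c + 1))"
     "summable (hyp_term (a + 1) b (c + 2))" "summable (hyp_term (a + 2) b (c + 2))"
    using assms[of a] assms[of "a + 1"] assms[of "a + 2"]
      summable_hyp_term_raise[OF assms[of "a + 1"]]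
    by (simp_all add: c_def algebra_simps)
  define f where "f n = hyp_term a b c n - (a + 1) * (a + 2 - 2 * b) * hyp_term (a + 2) b (c + 2) n" for n
  define V where "V n = (b - 1) * (hyp_term (a + 1) b (c + 1) n + (b - c - 1) * hyp_term (a + 1) b (c + 2) n)" for n
  have "f sums 0"
  proof (rule sums_0_telescope)
    have r: "rGamma c = c * (c + 1) * rGamma (c + 2)" "rGamma (c + 1) = (c + 1) * rGamma (c + 2)"
      using rGamma_plus1[of c] rGamma_plus1[of "c + 1"] by (simp_all add: add_ac mult.assoc)
    show "f 0 = V 0"
      unfolding f_def V_def hyp_term_0 r unfolding a by algebra
    have "V \<longlonglongrightarrow> (b - 1) * (0 + (b - c - 1) * 0)"
      unfolding V_def by (intro tendsto_intros summable_LIMSEQ_zero s)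
    then show "V \<longlonglongrightarrow> 0" by simp
    fix n
    define g where "g = rGamma (c + 2 + 1 + of_nat n)"
    have g: "rGamma (c + 2 + of_nat n) = (c + 2 + of_nat n) * g"
            "rGamma (c + 1 + of_nat n) = (c + 1 + of_nat n) * ((c + 2 + of_nat n) * g)"
      using rGamma_add_of_nat[of "c + 1" n] rGamma_add_of_nat[of "c + 2" n]
      by (simp_all add: g_def add.assoc)
    have g': "rGamma (c + of_nat (Suc n)) = (c + 1 + of_nat n) * ((c + 2 + of_nat n) * g)"
       "rGamma (c + 1 + of_nat (Suc n)) = (c + 2 + of_nat n) * g"
       "rGamma (c + 2 + of_nat (Suc n)) = g"
      using g by (simp_all add: g_def algebra_simps)
    have p: "pochhammer a (Suc n) = a * pochhammer (a + 1) n"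
      by (rule pochhammer_rec)
    \<comment> \<open>Kept multiplied by a + 1, which may be 0; \<open>f\<close> contains exactly
      this product.\<close>
    have p': "(a + 1) * pochhammer (a + 2) (Suc n) = pochhammer (a + 1) n * (a + 1 + of_nat n) * (a + 2 + of_nat n)"
      using pochhammer_rec[of "a + 1" "Suc n", symmetric] by (simp add: pochhammer_Suc algebra_simps)
    define N where "N = complex_of_nat n"
    define w where "w = (-1) ^ n * pochhammer (a + 1) n * pochhammer b n / fact n * g / (N + 1)"
    have nz: "N + 1 \<noteq> 0"
      unfolding N_def by (metis of_nat_Suc of_nat_neq_0 add.commute)
    have t: "hyp_term a b c (Suc n) = - (a * (b + N) * (c + 1 + N) * (c + 2 + N) * w)"
        "hyp_term (a + 1) b (c + 1) (Suc n) = - ((a + 1 + N) * (b + N) * (c + 2 + N) * w)"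
        "hyp_term (a + 1) b (c + 2) (Suc n) = - ((a + 1 + N) * (b + N) * w)"
        "hyp_term (a + 1) b (c + 1) n = (c + 1 + N) * (c + 2 + N) * (N + 1) * w"
        "hyp_term (a + 1) b (c + 2) n = (c + 2 + N) * (N + 1) * w"
      unfolding hyp_term_def g g' p w_def unfolding pochhammer_rec' fact_Suc using nz
      by (simp_all add: N_def add_ac mult_ac)
    have "(a + 1) * hyp_term (a + 2) b (c + 2) (Suc n) =
       (-1) ^ Suc n * (((a + 1) * pochhammer (a + 2) (Suc n)) * pochhammer b (Suc n) / fact (Suc n)) *
          rGamma (c + 2 + of_nat (Suc n))"
      unfolding hyp_term_def by simp
    also have "\<dots> = - ((a + 1 + N) * (a + 2 + N) * (b + N) * w)"
      unfolding g' p' w_def unfolding pochhammer_rec' fact_Suc using nz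
      by (simp add: N_def add_ac mult_ac)
    finally have t': "(a + 1) * hyp_term (a + 2) b (c + 2) (Suc n) = - ((a + 1 + N) * (a + 2 + N) * (b + N) * w)" .
    have f': "f (Suc n) = hyp_term a b c (Suc n) - (a + 2 - 2 * b) * ((a + 1) * hyp_term (a + 2) b (c + 2) (Suc n))"
      unfolding f_def by simp
    show "f (Suc n) = V (Suc n) - V n"
      unfolding f' V_def t t' unfolding a by algebra
  qed
  moreover have "f sums (hyp_sum a b c - (a + 1) * (a + 2 - 2 * b) * hyp_sum (a + 2) b (c + 2))"
    unfolding f_def hyp_sum_def by (intro sums_diff sums_add sums_mult summable_sums s)
  ultimately have "hyp_sum a b c - (a + 1) * (a + 2 - 2 * b) * hyp_sum (a + 2) b (c + 2) = 0"
    using sums_unique2 by blast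
  then show ?thesis by (simp add: c_def algebra_simps)
qed

lemma kummer_raise_left_iterate:
  assumes "\<And>a. summable (hyp_term a b (1 + a - b))"
  shows "hyp_sum a b (1 + a - b) =
    4 ^ k * pochhammer ((a + 1) / 2) k * pochhammer (1 + a / 2 - b) k *
      hyp_sum (a + 2 * of_nat k) b (1 + (a + 2 * of_nat k) - b)"
proof (induction k)
  case (Suc k)
  define A where "A = a + 2 * of_nat k"
  have *: "a + 2 * of_nat (Suc k) = A + 2" by (simp add: A_def algebra_simps)
  have "hyp_sum a b (1 + a - b) = 4 ^ k * pochhammer ((a + 1) / 2) k * pochhammer (1 + a / 2 - b) k *
     ((A + 1) * (A + 2 - 2 * b) * hyp_sum (A + 2) b (1 + (A + 2) - b))"
    using Suc kummer_raise_left[OF assms, of A] by (simp add: A_def)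
  also have "(A + 1) * (A + 2 - 2 * b) = 4 * ((a + 1) / 2 + of_nat k) * (1 + a / 2 - b + of_nat k)"
    by (simp add: A_def field_simps)
  finally show ?case
    unfolding * pochhammer_Suc by simp
qed simp

section \<open>Bounds and absolute convergence for Re b \<le> -1\<close>

text \<open>Gauss's product for 1/Gamma(b) converges, so its approximants are bounded; this makes
  (b)_(n+1)/(n+1)! of order n^(Re b)/(n+1), hence O(1/n^2).\<close>

lemma summable_norm_pochhammer_over_fact:
  assumes "Re b \<le> -1"
  shows "summable (\<lambda>n. norm (pochhammer b n / fact n))"
proof -
  have "Bseq (rGamma_series b)"
    using rGamma_series_LIMSEQ convergent_imp_Bseq convergent_def by blast
  then obtain B where B: "\<And>n. norm (rGamma_series b n) \<le> B" "B > 0"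
    unfolding Bseq_def by auto
  have ev: "\<forall>\<^sub>F n in sequentially.
      norm (norm (pochhammer b (Suc n) / fact (Suc n))) \<le> B * inverse (real n ^ 2)"
    using eventually_gt_at_top[of 0]
  proof eventually_elim
    case (elim n)
    define e where "e = exp (b * of_real (ln (of_nat n)))"
    have "norm e = exp (Re b * ln (real n))"
      by (simp add: e_def)
    also have "\<dots> \<le> exp (- 1 * ln (real n))"
      using assms elim by (subst exp_le_cancel_iff, intro mult_right_mono) auto
    also have "\<dots> = inverse (real n)"
      using elim by (simp add: exp_minus)
    finally have e: "norm e \<le> inverse (real n)" .
    have "pochhammer b (Suc n) / fact (Suc n) = rGamma_series b n * e * inverse (of_nat (Suc n))"
      by (simp add: rGamma_series_def e_def field_simps)
    then have "norm (pochhammer b (Suc n) / fact (Suc n)) =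
        norm (rGamma_series b n) * norm e * inverse (real (Suc n))"
      by (simp only: norm_mult norm_inverse norm_of_nat)
    also have "\<dots> \<le> B * inverse (real n) * inverse (real n)"
      using e B elim by (intro mult_mono le_imp_inverse_le) auto
    finally show ?case by (simp add: power2_eq_square)
  qed
  have "summable (\<lambda>n. norm (pochhammer b (Suc n) / fact (Suc n)))"
    by (rule summable_comparison_test_ev[OF ev]) (intro summable_mult inverse_power_summable, simp)
  then show ?thesis by (subst (asm) summable_Suc_iff)
qed

text \<open>The second assumption says that z and s have non-negative inner product. With Re s \<ge>
  0 this yields |z+n| \<le> |z+s+n| for all n, so the norm does not grow with n. The bound is
  uniform in n and serves as a dominating estimate.\<close>

lemma norm_pochhammer_rGamma_le:
  fixes z s :: complex
  assumes "Re s \<ge> 0" "Re z * Re s + Im z * Im s \<ge> 0"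
  shows "norm (pochhammer z n * rGamma (z + s + of_nat n)) \<le> norm (rGamma (z + s))"
proof (induction n)
  case (Suc n)
  have "norm (z + of_nat n) \<le> norm (z + s + of_nat n)"
  proof -
    have "(Re z + n) ^ 2 + Im z ^ 2 \<le> (Re z + Re s + n) ^ 2 + (Im z + Im s) ^ 2"
    proof -
      have "(Re z + Re s + n) ^ 2 + (Im z + Im s) ^ 2 = (Re z + n) ^ 2 + Im z ^ 2 +
         (Re s ^ 2 + Im s ^ 2 + 2 * (Re z * Re s + Im z * Im s) + 2 * real n * Re s)"
        by (simp add: power2_eq_square algebra_simps)
      moreover have "real n * Re s \<ge> 0" using assms by simp
      ultimately show ?thesis using assms by simp
    qed
    then show ?thesis by (simp add: cmod_def)
  qed
  then have "norm (pochhammer z n) * norm (rGamma (z + s + of_nat (Suc n))) * norm (z + of_nat n)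
     \<le> norm (pochhammer z n) * norm (rGamma (z + s + of_nat (Suc n))) * norm (z + s + of_nat n)"
    by (intro mult_left_mono) auto
  also have "\<dots> = norm (pochhammer z n * rGamma (z + s + of_nat n))"
    using rGamma_add_of_nat[of "z + s" n] by (simp add: norm_mult mult_ac add_ac)
  also note Suc
  finally show ?case by (simp add: pochhammer_Suc norm_mult mult_ac)
qed simp

lemma eventually_inner_shift_nonneg:
  fixes a s :: complex
  assumes "Re s > 0"
  shows "\<forall>\<^sub>F k in sequentially. Re (a + of_nat k) * Re s + Im (a + of_nat k) * Im s \<ge> 0"
proof -
  have "\<forall>\<^sub>F k in sequentially. real k \<ge> - (Re a * Re s + Im a * Im s) / Re s"
    by (rule eventually_compose_filterlim[OF eventually_ge_at_top filterlim_real_sequentially])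
  then show ?thesis
    by eventually_elim (use assms in \<open>simp add: field_simps\<close>)
qed

lemma summable_hyp_term_kummer:
  assumes "Re b \<le> -1"
  shows "summable (hyp_term a b (1 + a - b))"
proof -
  \<comment> \<open>After m factors of (a)_n are split off, a + m has non-negative inner product
    with 1 - b, and the uniform bound applies to the tail.\<close>
  obtain m where m: "Re (a + of_nat m) * Re (1 - b) + Im (a + of_nat m) * Im (1 - b) \<ge> 0"
    using eventually_happens[OF eventually_inner_shift_nonneg[of "1 - b" a]] assms by auto
  define C where "C = norm (pochhammer a m) * norm (rGamma (a + of_nat m + (1 - b)))"
  have bound: "norm (hyp_term a b (1 + a - b) (n + m)) \<le> C * norm (pochhammer b (n + m) / fact (n + m))" for n
  proof -
    have "norm (hyp_term a b (1 + a - b) (n + m)) = norm (pochhammer b (n + m) / fact (n + m)) *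
       (norm (pochhammer a m) * norm (pochhammer (a + of_nat m) n * rGamma (a + of_nat m + (1 - b) + of_nat n)))"
      unfolding hyp_term_def add.commute[of n m] pochhammer_product'[of a]
      by (simp add: norm_mult norm_divide norm_power algebra_simps)
    also have "\<dots> \<le> norm (pochhammer b (n + m) / fact (n + m)) * C"
      unfolding C_def
      by (intro mult_left_mono norm_pochhammer_rGamma_le m) (use assms in auto)
    finally show ?thesis by (simp add: mult.commute)
  qed
  have "summable (\<lambda>n. C * norm (pochhammer b (n + m) / fact (n + m)))"
    by (intro summable_mult)
       (subst summable_iff_shift, rule summable_norm_pochhammer_over_fact[OF assms])
  then have "summable (\<lambda>n. hyp_term a b (1 + a - b) (n + m))"
    by (rule summable_comparison_test'[where N = 0]) (rule bound)
  then show ?thesis by (subst (asm) summable_iff_shift)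
qed

section \<open>The limit as a tends to infinity in steps of 2\<close>

lemma tendsto_pochhammer_quotient:
  fixes z :: "'a \<Rightarrow> complex"
  assumes "filterlim z at_infinity F"
  shows "((\<lambda>k. pochhammer (z k) n / pochhammer (z k + s) n) \<longlongrightarrow> 1) F"
proof (induction n)
  case (Suc n)
  have inf: "filterlim (\<lambda>k. z k + (s + of_nat n)) at_infinity F"
    by (rule tendsto_add_filterlim_at_infinity'[OF assms tendsto_const])
  have "((\<lambda>k. 1 - s * inverse (z k + (s + of_nat n))) \<longlongrightarrow> 1 - s * 0) F"
    by (intro tendsto_intros filterlim_compose[OF tendsto_inverse_0 inf])
  moreover have "\<forall>\<^sub>F k in F. 1 - s * inverse (z k + (s + of_nat n)) = (z k + of_nat n) / (z k + s + of_nat n)"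
    using filterlim_at_infinity_imp_eventually_ne[OF inf, of 0]
    by eventually_elim (simp add: field_simps)
  ultimately have "((\<lambda>k. (z k + of_nat n) / (z k + s + of_nat n)) \<longlongrightarrow> 1) F"
    by (simp add: tendsto_cong)
  from tendsto_mult[OF Suc this] show ?case
    by (simp add: pochhammer_Suc)
qed simp

text \<open>Gauss's product for each of the four Gamma values: the factorials cancel, and so do the
  powers of k, because u + v = x + y. The approximant with index k contains the Pochhammer symbol of
  length k + 1, hence the index shift.\<close>

lemma tendsto_pochhammer_ratio:
  fixes u v x y :: complex
  assumes "u + v = x + y" "x \<notin> \<int>\<^sub>\<le>\<^sub>0" "y \<notin> \<int>\<^sub>\<le>\<^sub>0"
  shows "(\<lambda>k. pochhammer u k * pochhammer v k / (pochhammer x k * pochhammer y k))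
            \<longlonglongrightarrow> rGamma u * rGamma v / (rGamma x * rGamma y)"
proof (rule LIMSEQ_imp_Suc)
  have "(\<lambda>k. rGamma_series u k * rGamma_series v k / (rGamma_series x k * rGamma_series y k))
            \<longlonglongrightarrow> rGamma u * rGamma v / (rGamma x * rGamma y)"
    using assms by (intro tendsto_intros) (auto simp: rGamma_eq_zero_iff)
  also have "(\<lambda>k. rGamma_series u k * rGamma_series v k / (rGamma_series x k * rGamma_series y k)) =
    (\<lambda>k. pochhammer u (Suc k) * pochhammer v (Suc k) / (pochhammer x (Suc k) * pochhammer y (Suc k)))"
  proof
    fix k
    define L where "L = complex_of_real (ln (of_nat k))"
    have e: "exp (u * L) * exp (v * L) = exp (x * L) * exp (y * L)"
      by (simp flip: exp_add distrib_right add: assms(1))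
    have "rGamma_series u k * rGamma_series v k / (rGamma_series x k * rGamma_series y k) =
       pochhammer u (Suc k) * pochhammer v (Suc k) / (pochhammer x (Suc k) * pochhammer y (Suc k)) *
         ((exp (x * L) * exp (y * L)) / (exp (u * L) * exp (v * L)))"
      unfolding rGamma_series_def L_def[symmetric] by (simp add: mult_ac)
    then show "rGamma_series u k * rGamma_series v k / (rGamma_series x k * rGamma_series y k) =
       pochhammer u (Suc k) * pochhammer v (Suc k) / (pochhammer x (Suc k) * pochhammer y (Suc k))"
      by (simp add: e)
  qed
  finally show "(\<lambda>k. pochhammer u (Suc k) * pochhammer v (Suc k) / (pochhammer x (Suc k) * pochhammer y (Suc k)))
            \<longlonglongrightarrow> rGamma u * rGamma v / (rGamma x * rGamma y)" .
qed

lemma Re_pos_notin_nonpos_Ints: "Re z > 0 \<Longrightarrow> z \<notin> \<int>\<^sub>\<le>\<^sub>0"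
  by (auto elim!: nonpos_Ints_cases)

lemma tendsto_kummer_normalised:
  assumes b: "Re b \<le> -1"
  shows "(\<lambda>k. Gamma (1 + (a + 2 * of_nat k) - b) * hyp_sum (a + 2 * of_nat k) b (1 + (a + 2 * of_nat k) - b))
     \<longlonglongrightarrow> (\<Sum>n. (-1) ^ n * (pochhammer b n / fact n))"
proof -
  define z where "z k = a + 2 * of_nat k" for k :: nat
  define s where "s = 1 - b"
  have s: "Re s > 0" "1 + z k - b = z k + s" for k using b by (simp_all add: s_def)
  define T where "T n k = (-1) ^ n * (pochhammer b n / fact n) *
     (Gamma (z k + s) * (pochhammer (z k) n * rGamma (z k + s + of_nat n)))" for n k
  have pos: "\<forall>\<^sub>F k in sequentially. Re (z k + s) > 0"
  proof -
    have "\<forall>\<^sub>F k in sequentially. real k > - Re (a + s) / 2"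
      by (rule eventually_compose_filterlim[OF eventually_gt_at_top filterlim_real_sequentially])
    then show ?thesis by eventually_elim (simp add: z_def field_simps)
  qed
  have inf: "filterlim z at_infinity sequentially"
    unfolding z_def
    by (intro tendsto_add_filterlim_at_infinity[OF tendsto_const]
          tendsto_mult_filterlim_at_infinity[OF tendsto_const] tendsto_of_nat) simp
  have inner: "\<forall>\<^sub>F k in sequentially. Re (z k) * Re s + Im (z k) * Im s \<ge> 0"
    using eventually_compose_filterlim[OF eventually_inner_shift_nonneg[OF s(1), of a]
             mult_nat_left_at_top[of 2]]
    by (simp add: z_def)
  have bound: "\<forall>\<^sub>F k in sequentially. \<forall>n. norm (T n k) \<le> norm (pochhammer b n / fact n)"
    using pos inner
  proof eventually_elim
    case (elim k)
    show ?case
    proof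
      fix n
      have "rGamma (z k + s) \<noteq> 0"
        using Re_pos_notin_nonpos_Ints[OF elim(1)] by (simp add: rGamma_eq_zero_iff)
      then have 1: "norm (Gamma (z k + s)) * norm (rGamma (z k + s)) = 1"
        by (simp add: rGamma_inverse_Gamma norm_inverse)
      have "norm (T n k) = norm (pochhammer b n / fact n) *
        (norm (Gamma (z k + s)) * norm (pochhammer (z k) n * rGamma (z k + s + of_nat n)))"
        by (simp add: T_def norm_mult norm_power norm_divide)
      also have "\<dots> \<le> norm (pochhammer b n / fact n) * (norm (Gamma (z k + s)) * norm (rGamma (z k + s)))"
        by (intro mult_left_mono norm_pochhammer_rGamma_le elim less_imp_le[OF s(1)]) auto
      finally show "norm (T n k) \<le> norm (pochhammer b n / fact n)"
        by (simp add: 1)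
    qed
  qed
  have lim: "(\<lambda>k. T n k) \<longlonglongrightarrow> (-1) ^ n * (pochhammer b n / fact n)" for n
  proof -
    have "\<forall>\<^sub>F k in sequentially. pochhammer (z k) n / pochhammer (z k + s) n =
        Gamma (z k + s) * (pochhammer (z k) n * rGamma (z k + s + of_nat n))"
      using pos
    proof eventually_elim
      case (elim k)
      show ?case
        unfolding pochhammer_Gamma[OF Re_pos_notin_nonpos_Ints[OF elim]]
        by (simp add: rGamma_inverse_Gamma field_simps)
    qed
    then have "(\<lambda>k. Gamma (z k + s) * (pochhammer (z k) n * rGamma (z k + s + of_nat n))) \<longlonglongrightarrow> 1"
      using tendsto_pochhammer_quotient[OF inf, of n s] by (simp add: tendsto_cong)
    from tendsto_mult[OF tendsto_const this, of "(-1) ^ n * (pochhammer b n / fact n)"]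
    show ?thesis by (simp add: T_def)
  qed
  have "(\<lambda>k. \<Sum>n. T n k) \<longlonglongrightarrow> (\<Sum>n. (-1) ^ n * (pochhammer b n / fact n))"
  proof (rule tannerys_theorem[THEN conjunct2, THEN conjunct2])
    show "(\<lambda>k. T n k) \<longlonglongrightarrow> (-1) ^ n * (pochhammer b n / fact n)" for n by (rule lim)
    show "summable (\<lambda>n. norm (pochhammer b n / fact n))"
      by (rule summable_norm_pochhammer_over_fact[OF b])
    show "\<forall>\<^sub>F (n, k) in sequentially \<times>\<^sub>F sequentially. norm (T n k) \<le> norm (pochhammer b n / fact n)"
      by (rule eventually_mono[OF eventually_prodI[OF eventually_True bound]]) auto
  qed simp
  moreover have "(\<Sum>n. T n k) = Gamma (1 + z k - b) * hyp_sum (z k) b (1 + z k - b)" for k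
    unfolding hyp_sum_def
    by (subst suminf_mult[symmetric, OF summable_hyp_term_kummer[OF b]])
       (simp add: T_def hyp_term_def s mult_ac)
  ultimately show ?thesis by (simp add: z_def)
qed

section \<open>Evaluation of the limit, of the constant in b, and Kummer's theorem in
  general\<close>

lemma Gamma_legendre_duplication_powr:
  fixes z :: complex
  assumes "z \<notin> \<int>\<^sub>\<le>\<^sub>0" "z + 1/2 \<notin> \<int>\<^sub>\<le>\<^sub>0"
  shows "Gamma z * Gamma (z + 1/2) = 2 powr (1 - 2 * z) * of_real (sqrt pi) * Gamma (2 * z)"
proof -
  have "Ln 2 = of_real (ln 2)" using Ln_of_real[of 2] by simp
  then show ?thesis
    unfolding Gamma_legendre_duplication[OF assms] by (simp add: powr_def)
qed

text \<open>The iterated recurrence writes the sum as Q k G k for every k, with G the normalised sum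
  and Q an explicit product. Both factors converge, so the constant product equals the product of
  the limits. The condition on a keeps Gamma(1+a+2k-b) finite and nonzero for all k.\<close>

lemma kummer_up_to_constant:
  assumes b: "Re b \<le> -1" and a: "Re (1 + a - b) > 0"
  shows "hyp_sum a b (1 + a - b) = 2 powr (b - a) * of_real (sqrt pi) *
     rGamma ((a + 1) / 2) * rGamma (1 + a / 2 - b) * (\<Sum>n. (-1) ^ n * (pochhammer b n / fact n))"
proof -
  \<comment> \<open>Half of the lower parameter: (2x)_(2k) splits into 4^k (x)_k (x+1/2)_k, which
    cancels the 4^k in \<open>Q\<close>, and u + v = x + (x+1/2) balances the ratio.\<close>
  define x where "x = (1 + a - b) / 2"
  define u v where "u = (a + 1) / 2" and "v = 1 + a / 2 - b"
  have x: "x \<notin> \<int>\<^sub>\<le>\<^sub>0" "x + 1/2 \<notin> \<int>\<^sub>\<le>\<^sub>0" "2 * x \<notin> \<int>\<^sub>\<le>\<^sub>0"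
  proof -
    have "Re x > 0" using a by (simp add: x_def)
    then show "x \<notin> \<int>\<^sub>\<le>\<^sub>0" "x + 1/2 \<notin> \<int>\<^sub>\<le>\<^sub>0" "2 * x \<notin> \<int>\<^sub>\<le>\<^sub>0"
      by (simp_all add: Re_pos_notin_nonpos_Ints)
  qed
  define Q where "Q k = 4 ^ k * pochhammer u k * pochhammer v k * rGamma (2 * x + 2 * of_nat k)" for k
  define L where "L = (\<Sum>n. (-1) ^ n * (pochhammer b n / fact n))"
  define G where "G k = Gamma (1 + (a + 2 * of_nat k) - b) * hyp_sum (a + 2 * of_nat k) b (1 + (a + 2 * of_nat k) - b)" for k
  have "Q k = rGamma (2 * x) * (pochhammer u k * pochhammer v k / (pochhammer x k * pochhammer (x + 1/2) k))" for k
  proof -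
    have "rGamma (2 * x) = pochhammer (2 * x) (2 * k) * rGamma (2 * x + of_nat (2 * k))"
      by (rule pochhammer_rGamma)
    also have "pochhammer (2 * x) (2 * k) = 4 ^ k * pochhammer x k * pochhammer (x + 1/2) k"
      by (simp add: pochhammer_double power_mult)
    finally have "rGamma (2 * x) = 4 ^ k * pochhammer x k * pochhammer (x + 1/2) k * rGamma (2 * x + 2 * of_nat k)"
      by simp
    moreover have "pochhammer x k \<noteq> 0" "pochhammer (x + 1/2) k \<noteq> 0"
      using x by (auto simp: pochhammer_eq_0_iff)
    ultimately show ?thesis
      unfolding Q_def by (simp add: field_simps)
  qed
  moreover have "u + v = x + (x + 1/2)"
    by (simp add: u_def v_def x_def field_simps)
  ultimately have "Q \<longlonglongrightarrow> rGamma (2 * x) * (rGamma u * rGamma v / (rGamma x * rGamma (x + 1/2)))"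
    using tendsto_mult[OF tendsto_const tendsto_pochhammer_ratio[OF _ x(1,2)]] by presburger
  moreover have "G \<longlonglongrightarrow> L"
    unfolding G_def L_def by (rule tendsto_kummer_normalised[OF b])
  ultimately have "(\<lambda>k. Q k * G k) \<longlonglongrightarrow> rGamma (2 * x) * (rGamma u * rGamma v / (rGamma x * rGamma (x + 1/2))) * L"
    by (rule tendsto_mult)
  moreover have "Q k * G k = hyp_sum a b (1 + a - b)" for k
  proof -
    have "Re (1 + (a + 2 * of_nat k) - b) > 0" using a by simp
    from Re_pos_notin_nonpos_Ints[OF this]
    have "rGamma (1 + (a + 2 * of_nat k) - b) * Gamma (1 + (a + 2 * of_nat k) - b) = 1"
      by (simp add: rGamma_inverse_Gamma Gamma_eq_zero_iff)
    moreover have "2 * x + 2 * of_nat k = 1 + (a + 2 * of_nat k) - b"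
      by (simp add: x_def)
    moreover have "Q k * G k = 4 ^ k * pochhammer u k * pochhammer v k *
       hyp_sum (a + 2 * of_nat k) b (1 + (a + 2 * of_nat k) - b) *
       (rGamma (2 * x + 2 * of_nat k) * Gamma (1 + (a + 2 * of_nat k) - b))"
      unfolding Q_def G_def by (simp only: mult_ac)
    ultimately have "Q k * G k = 4 ^ k * pochhammer u k * pochhammer v k *
       hyp_sum (a + 2 * of_nat k) b (1 + (a + 2 * of_nat k) - b)"
      by (simp only: mult_1_right)
    also have "\<dots> = hyp_sum a b (1 + a - b)"
      unfolding u_def v_def
      by (rule kummer_raise_left_iterate[symmetric]) (rule summable_hyp_term_kummer[OF b])
    finally show ?thesis .
  qed
  ultimately have "hyp_sum a b (1 + a - b) = rGamma (2 * x) * (rGamma u * rGamma v / (rGamma x * rGamma (x + 1/2))) * L"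
    by (simp add: LIMSEQ_const_iff)
  also have "\<dots> = (Gamma x * Gamma (x + 1/2)) * rGamma (2 * x) * rGamma u * rGamma v * L"
    by (simp add: rGamma_inverse_Gamma field_simps)
  also have "Gamma x * Gamma (x + 1/2) = 2 powr (b - a) * of_real (sqrt pi) * Gamma (2 * x)"
  proof -
    have "1 - 2 * x = b - a" by (simp add: x_def field_simps)
    then show ?thesis using Gamma_legendre_duplication_powr[OF x(1,2)] by (simp only:)
  qed
  also have "\<dots> * rGamma (2 * x) = 2 powr (b - a) * of_real (sqrt pi)"
    using x(3) by (simp add: rGamma_inverse_Gamma Gamma_eq_zero_iff)
  finally show ?thesis by (simp only: u_def v_def L_def)
qed

lemma hyp_sum_0_left [simp]: "hyp_sum 0 b c = rGamma c"
proof -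
  have "hyp_term 0 b c n = 0" if "n \<notin> {0}" for n
    using that by (cases n) (simp_all add: hyp_term_def pochhammer_rec)
  from suminf_finite[of "{0}", OF _ this] show ?thesis
    by (simp add: hyp_sum_def)
qed

lemma rGamma_one_half: "rGamma (1/2 :: complex) = inverse (of_real (sqrt pi))"
  by (simp add: rGamma_inverse_Gamma Gamma_one_half_complex)

lemma kummer_Re_le:
  assumes b: "Re b \<le> -1"
  shows "hyp_sum a b (1 + a - b) =
    2 powr (- a) * of_real (sqrt pi) * rGamma ((a + 1) / 2) * rGamma (1 + a / 2 - b)"
proof -
  define L where "L = (\<Sum>n. (-1) ^ n * (pochhammer b n / fact n))"
  \<comment> \<open>At a = 0 only the first term of the series survives, which determines the
    constant as 2^(-b).\<close>
  have "rGamma (1 - b) = 2 powr b * of_real (sqrt pi) * rGamma (1/2) * rGamma (1 - b) * L"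
    using kummer_up_to_constant[OF b, of 0] b by (simp add: L_def)
  moreover have "rGamma (1 - b) \<noteq> 0"
    using b by (simp add: rGamma_eq_zero_iff Re_pos_notin_nonpos_Ints)
  ultimately have L: "2 powr b * L = 1"
    by (simp add: rGamma_one_half field_simps)
  have main: "hyp_sum a b (1 + a - b) =
    2 powr (- a) * of_real (sqrt pi) * rGamma ((a + 1) / 2) * rGamma (1 + a / 2 - b)"
    if "Re (1 + a - b) > 0" for a
  proof -
    have "2 powr (b - a) = 2 powr b * 2 powr (- a)"
      by (simp flip: powr_add)
    then have "hyp_sum a b (1 + a - b) = (2 powr b * L) * (2 powr (- a) * of_real (sqrt pi) *
       rGamma ((a + 1) / 2) * rGamma (1 + a / 2 - b))"
      using kummer_up_to_constant[OF b that] by (simp add: L_def mult_ac)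
    then show ?thesis by (simp add: L)
  qed
  \<comment> \<open>Raising a by 2k reaches the half plane already treated; the recurrence carries
    the value back to a.\<close>
  obtain k :: nat where k: "real k > - Re (1 + a - b)"
    using reals_Archimedean2 by blast
  define A where "A = a + 2 * of_nat k"
  have "hyp_sum a b (1 + a - b) = 4 ^ k * pochhammer ((a + 1) / 2) k * pochhammer (1 + a / 2 - b) k *
     hyp_sum A b (1 + A - b)"
    unfolding A_def by (rule kummer_raise_left_iterate) (rule summable_hyp_term_kummer[OF b])
  also have "hyp_sum A b (1 + A - b) =
    2 powr (- A) * of_real (sqrt pi) * rGamma ((A + 1) / 2) * rGamma (1 + A / 2 - b)"
    by (rule main) (use k in \<open>simp add: A_def\<close>)
  also have "2 powr (- A) = 2 powr (- a) / 4 ^ k"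
  proof -
    have "2 powr (- A) = 2 powr (- a) * (2 powr (- 2)) ^ k"
      by (simp add: A_def powr_def exp_add exp_diff exp_minus exp_of_nat_mult ring_distribs field_simps flip: exp_of_nat_mult)
    then show ?thesis
      by (simp add: powr_minus field_simps)
  qed
  also have "(A + 1) / 2 = (a + 1) / 2 + of_nat k" by (simp add: A_def field_simps)
  also have "1 + A / 2 - b = 1 + a / 2 - b + of_nat k" by (simp add: A_def field_simps)
  finally show ?thesis
    unfolding pochhammer_rGamma[of "(a + 1) / 2" k] pochhammer_rGamma[of "1 + a / 2 - b" k]
    by simp
qed

text \<open>Induction on a bound for Re b. Each step lowers b by one, and its factor (2+a-2b)/2 =
  1+a/2-b is absorbed by the functional equation of 1/Gamma. Convergence passes to the lowered b, so
  conditionally convergent series are covered.\<close>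

theorem kummer:
  assumes "summable (hyp_term a b (1 + a - b))"
  shows "hyp_sum a b (1 + a - b) =
    2 powr (- a) * of_real (sqrt pi) * rGamma ((a + 1) / 2) * rGamma (1 + a / 2 - b)"
proof -
  obtain k :: nat where "Re b + 1 \<le> real k"
    using real_arch_simple by blast
  then show ?thesis using assms
  proof (induction k arbitrary: b)
    case 0
    then show ?case by (intro kummer_Re_le) simp
  next
    case (Suc k)
    have "summable (hyp_term a (b - 1) (1 + a - b + 1))"
      using Suc.prems by (intro summable_hyp_term_lower_right summable_hyp_term_raise)
    then have "hyp_sum a (b - 1) (1 + a - (b - 1)) =
       2 powr (- a) * of_real (sqrt pi) * rGamma ((a + 1) / 2) * rGamma (1 + a / 2 - (b - 1))"
      using Suc.prems by (intro Suc.IH) (simp_all add: algebra_simps)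
    also have "1 + a - (b - 1) = 2 + a - b" by simp
    also have "1 + a / 2 - (b - 1) = (1 + a / 2 - b) + 1" by simp
    finally have "2 * hyp_sum a b (1 + a - b) = (2 + a - 2 * b) *
       (2 powr (- a) * of_real (sqrt pi) * rGamma ((a + 1) / 2) * rGamma ((1 + a / 2 - b) + 1))"
      using kummer_lower_right[OF Suc.prems(2)] by simp
    also have "\<dots> = 2 * (2 powr (- a) * of_real (sqrt pi) * rGamma ((a + 1) / 2) *
        ((1 + a / 2 - b) * rGamma ((1 + a / 2 - b) + 1)))"
      by (simp add: field_simps)
    finally show ?case
      unfolding rGamma_plus1 by simp
  qed
qed

text \<open>The duplication formula at z = (a+1)/2 - b removes sqrt(pi) and gives the shape of the
  generalized formulas at i = 0, the base case of both inductions.\<close>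

lemma kummer_Gamma:
  assumes "summable (hyp_term a b (1 + a - b))" "(a + 1) / 2 - b \<notin> \<int>\<^sub>\<le>\<^sub>0"
  shows "hyp_sum a b (1 + a - b) =
    2 powr (- 2 * b) * rGamma (1 + a - 2 * b) * (Gamma ((a + 1) / 2 - b) * rGamma ((a + 1) / 2))"
proof -
  define z where "z = (a + 1) / 2 - b"
  have z: "2 * z = 1 + a - 2 * b" "z + 1 / 2 = 1 + a / 2 - b"
    by (simp_all add: z_def field_simps)
  have "2 powr (- a) * of_real (sqrt pi) * rGamma (z + 1 / 2) =
     2 powr (- 2 * b) * rGamma (2 * z) * Gamma z"
  proof (cases "z + 1 / 2 \<in> \<int>\<^sub>\<le>\<^sub>0")
    \<comment> \<open>Then 2z is a negative odd integer, and both sides vanish.\<close>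
    case True
    then obtain n where "z + 1 / 2 = - of_nat n" by (elim nonpos_Ints_cases')
    then have "z = - of_nat n - 1 / 2" by (simp add: eq_diff_eq)
    then have "2 * z = - of_nat (2 * n + 1)" by simp
    then have "2 * z \<in> \<int>\<^sub>\<le>\<^sub>0" by (metis minus_of_nat_in_nonpos_Ints)
    with True show ?thesis by (simp add: rGamma_eq_zero_iff[THEN iffD2])
  next
    case False
    \<comment> \<open>By parity, 2z in the non-positive integers would put z or z + 1/2
      there.\<close>
    have "2 * z \<notin> \<int>\<^sub>\<le>\<^sub>0"
    proof
      assume "2 * z \<in> \<int>\<^sub>\<le>\<^sub>0"
      then obtain n where n: "2 * z = - of_nat n" by (elim nonpos_Ints_cases')
      show False
      proof (cases "even n")
        case True
        then obtain m where "n = 2 * m" by blast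
        with n have "z = - of_nat m" by simp
        then show False using assms(2) by (simp add: z_def)
      next
        case odd: False
        then obtain m where "n = 2 * m + 1" by (elim oddE)
        with n have "2 * z = 2 * (- of_nat m - 1 / 2)" by simp
        then have "z + 1 / 2 = - of_nat m" by (simp only: mult_cancel_left) simp
        then show False using False by simp
      qed
    qed
    then have nz: "Gamma (2 * z) \<noteq> 0" "Gamma (z + 1/2) \<noteq> 0"
      using False by (simp_all add: Gamma_eq_zero_iff)
    have "Gamma z * Gamma (z + 1/2) = 2 powr (1 - 2 * z) * of_real (sqrt pi) * Gamma (2 * z)"
      using Gamma_legendre_duplication_powr[of z] assms(2) False by (simp add: z_def)
    moreover have "2 powr (1 - 2 * z) * 2 powr (- 2 * b) = (2 powr (- a) :: complex)"
      by (simp add: z flip: powr_add)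
    ultimately have "2 powr (- a) * of_real (sqrt pi) * Gamma (2 * z) =
        2 powr (- 2 * b) * (Gamma z * Gamma (z + 1/2))"
      by (simp only: mult_ac)
    then show ?thesis
      using nz unfolding rGamma_inverse_Gamma divide_inverse[symmetric]
      by (simp add: divide_simps mult_ac)
  qed
  then show ?thesis
    unfolding kummer[OF assms(1)] z unfolding z_def by (simp add: mult_ac)
qed

subsection \<open>Generalized Kummer theorems\<close>

text \<open>Pascal's rule in the shape in which the two neighbours of a contiguous relation
  contribute: one with the same index, one with the index shifted.\<close>

lemma sum_choose_Suc:
  fixes f :: "nat \<Rightarrow> 'a :: comm_semiring_1"
  shows "(\<Sum>r\<le>Suc n. of_nat (Suc n choose r) * f r) =
    (\<Sum>r\<le>n. of_nat (n choose r) * f r) + (\<Sum>r\<le>n. of_nat (n choose r) * f (Suc r))"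
proof -
  have "(\<Sum>r\<le>Suc n. of_nat (Suc n choose r) * f r) =
      f 0 + ((\<Sum>r\<le>n. of_nat (n choose r) * f (Suc r)) + (\<Sum>r\<le>n. of_nat (n choose Suc r) * f (Suc r)))"
    by (simp add: sum.atMost_Suc_shift sum.distrib ring_distribs del: sum.atMost_Suc)
  also have "\<dots> = (\<Sum>r\<le>n. of_nat (n choose r) * f (Suc r)) + (f 0 + (\<Sum>r\<le>n. of_nat (n choose Suc r) * f (Suc r)))"
    by (simp only: add_ac)
  also have "f 0 + (\<Sum>r\<le>n. of_nat (n choose Suc r) * f (Suc r)) = (\<Sum>r\<le>Suc n. of_nat (n choose r) * f r)"
    by (simp add: sum.atMost_Suc_shift del: sum.atMost_Suc)
  also have "\<dots> = (\<Sum>r\<le>n. of_nat (n choose r) * f r)"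
    by (simp add: binomial_eq_0)
  finally show ?thesis by (simp add: add_ac)
qed

text \<open>Induction on i for all a at once, since one neighbour has first parameter a - 1. That
  neighbour yields the summands \<open>h r\<close>, the other \<open>h (Suc r)\<close>, and Pascal's
  rule merges them. The factor c - b matches the two reciprocal Gamma prefactors, and the 2 on the
  left lowers the power of 2.\<close>

lemma generalized_kummer_minus:
  assumes "summable (hyp_term a b (1 + a - b - of_nat i))"
    and "\<And>r. r \<le> i \<Longrightarrow> (a - of_nat i + of_nat r + 1) / 2 - b \<notin> \<int>\<^sub>\<le>\<^sub>0"
  shows "hyp_sum a b (1 + a - b - of_nat i) =
    2 powr (- of_nat i - 2 * b) * rGamma (1 + a - 2 * b - of_nat i) *
    (\<Sum>r\<le>i. of_nat (i choose r) *
       (Gamma ((a - of_nat i + of_nat r + 1) / 2 - b) * rGamma ((a - of_nat i + of_nat r + 1) / 2)))"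
  using assms
proof (induction i arbitrary: a)
  case 0
  then show ?case using kummer_Gamma[of a b] by simp
next
  case (Suc i)
  define c where "c = 1 + a - b - of_nat (Suc i)"
  define h where "h r = Gamma ((a - of_nat (Suc i) + of_nat r + 1) / 2 - b) *
     rGamma ((a - of_nat (Suc i) + of_nat r + 1) / 2)" for r
  have c: "1 + (a - 1) - b - of_nat i = c" "1 + a - b - of_nat i = c + 1"
    by (simp_all add: c_def)
  have s: "summable (hyp_term a b c)"
    using Suc.prems(1) by (simp add: c_def)
  have 1: "hyp_sum (a - 1) b c = 2 powr (- of_nat i - 2 * b) * rGamma (c - b) *
     (\<Sum>r\<le>i. of_nat (i choose r) * h r)"
  proof -
    have "(a - 1 - of_nat i + of_nat r + 1) / 2 - b \<notin> \<int>\<^sub>\<le>\<^sub>0" if "r \<le> i" for r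
      using Suc.prems(2)[of r] that by (simp add: algebra_simps)
    from Suc.IH[of "a - 1", OF _ this] show ?thesis
      using summable_hyp_term_lower_left[OF s] by (simp add: c h_def) (simp add: c_def algebra_simps)
  qed
  have 2: "hyp_sum a b (c + 1) = 2 powr (- of_nat i - 2 * b) * rGamma (c - b + 1) *
     (\<Sum>r\<le>i. of_nat (i choose r) * h (Suc r))"
  proof -
    have "(a - of_nat i + of_nat r + 1) / 2 - b \<notin> \<int>\<^sub>\<le>\<^sub>0" if "r \<le> i" for r
      using Suc.prems(2)[of "Suc r"] that by (simp add: algebra_simps)
    from Suc.IH[of a, OF _ this] show ?thesis
      using summable_hyp_term_raise[OF s] by (simp add: c h_def) (simp add: c_def algebra_simps)
  qed
  have "2 * hyp_sum a b c = 2 powr (- of_nat i - 2 * b) *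
     (rGamma (c - b) * (\<Sum>r\<le>i. of_nat (i choose r) * h r) +
      ((c - b) * rGamma (c - b + 1)) * (\<Sum>r\<le>i. of_nat (i choose r) * h (Suc r)))"
    unfolding hyp_sum_contiguous_minus[OF s] 1 2 by (simp add: algebra_simps)
  also have "\<dots> = 2 powr (- of_nat i - 2 * b) * rGamma (c - b) * (\<Sum>r\<le>Suc i. of_nat (Suc i choose r) * h r)"
    unfolding rGamma_plus1 sum_choose_Suc by (simp only: distrib_left mult.assoc)
  also have "2 powr (- of_nat i - 2 * b) = 2 * 2 powr (- of_nat (Suc i) - 2 * b)"
    using powr_add[of 2 1 "- of_nat (Suc i) - 2 * b"] by (simp add: algebra_simps)
  finally have "hyp_sum a b c = 2 powr (- of_nat (Suc i) - 2 * b) * rGamma (c - b) *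
      (\<Sum>r\<le>Suc i. of_nat (Suc i choose r) * h r)"
    by simp
  also have "c - b = 1 + a - 2 * b - of_nat (Suc i)"
    by (simp add: c_def)
  finally show ?case
    unfolding c_def h_def .
qed

text \<open>As in the other direction, but b is lowered too, with b - i unchanged from step to step.
  The shifted neighbour enters with a minus sign, which the alternating sign of
  \<open>h (Suc r)\<close> compensates.\<close>

lemma generalized_kummer_plus:
  assumes "summable (hyp_term a b (1 + a - b + of_nat i))" and "b - of_nat i \<notin> \<int>\<^sub>\<le>\<^sub>0"
    and "\<And>r. r \<le> i \<Longrightarrow> (a + of_nat i + of_nat r + 1) / 2 - b \<notin> \<int>\<^sub>\<le>\<^sub>0"
  shows "hyp_sum a b (1 + a - b + of_nat i) =
    2 powr (of_nat i - 2 * b) * (Gamma (b - of_nat i) * rGamma b) * rGamma (1 + a - 2 * b + of_nat i) *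
    (\<Sum>r\<le>i. of_nat (i choose r) * ((-1) ^ r *
       (Gamma ((a + of_nat i + of_nat r + 1) / 2 - b) * rGamma ((a - of_nat i + of_nat r + 1) / 2))))"
  using assms
proof (induction i arbitrary: a b)
  case 0
  then have "Gamma b * rGamma b = 1"
    by (simp add: rGamma_inverse_Gamma Gamma_eq_zero_iff)
  then show ?case using 0 kummer_Gamma[of a b] by simp
next
  case (Suc i)
  define c where "c = 1 + a - b + of_nat (Suc i)"
  define h where "h r = (-1) ^ r * (Gamma ((a + of_nat (Suc i) + of_nat r + 1) / 2 - b) *
     rGamma ((a - of_nat (Suc i) + of_nat r + 1) / 2))" for r
  define K where "K = 2 powr (of_nat (Suc i) - 2 * b) * Gamma (b - of_nat (Suc i)) * rGamma (c - b)"
  have c: "1 + (a - 1) - (b - 1) + of_nat i = c - 1" "1 + a - (b - 1) + of_nat i = c"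
    by (simp_all add: c_def)
  have s: "summable (hyp_term a b c)"
    using Suc.prems(1) by (simp add: c_def)
  \<comment> \<open>b = 1 would make b - (i+1) = -i, a pole excluded by assumption. This allows the
    final division by b - 1.\<close>
  have b: "b - 1 \<noteq> 0"
    using Suc.prems(2) by (auto simp: algebra_simps)
  have b1: "b - 1 - of_nat i \<notin> \<int>\<^sub>\<le>\<^sub>0"
    using Suc.prems(2) by (simp add: algebra_simps)
  have e: "2 powr (of_nat i - 2 * (b - 1)) = 2 * (2 powr (of_nat (Suc i) - 2 * b) :: complex)"
    using powr_add[of 2 1 "of_nat (Suc i) - 2 * b"] by (simp add: algebra_simps)
  have 1: "hyp_sum (a - 1) (b - 1) (c - 1) = 2 * K * rGamma (b - 1) *
     (\<Sum>r\<le>i. of_nat (i choose r) * h r)"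
  proof -
    have "(a - 1 + of_nat i + of_nat r + 1) / 2 - (b - 1) \<notin> \<int>\<^sub>\<le>\<^sub>0" if "r \<le> i" for r
      using Suc.prems(3)[of r] that by (simp add: field_simps)
    note IH = Suc.IH[of "a - 1" "b - 1", unfolded c e, OF _ b1 this]
    have eqs: "(a - 1 + of_nat i + of_nat r + 1) / 2 - (b - 1) = (a + of_nat (Suc i) + of_nat r + 1) / 2 - b"
       "(a - 1 - of_nat i + of_nat r + 1) / 2 = (a - of_nat (Suc i) + of_nat r + 1) / 2"
       "b - 1 - of_nat i = b - of_nat (Suc i)"
       "1 + (a - 1) - 2 * (b - 1) + of_nat i = c - b" for r
      by (simp_all add: c_def field_simps)
    show ?thesis
      using IH[OF summable_hyp_term_lower_left_lower[OF summable_hyp_term_lower_right[OF s]]]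
      unfolding eqs h_def K_def by (simp only: mult_ac)
  qed
  have 2: "(c - b) * hyp_sum a (b - 1) c = - (2 * K * rGamma (b - 1) *
     (\<Sum>r\<le>i. of_nat (i choose r) * h (Suc r)))"
  proof -
    have "(a + of_nat i + of_nat r + 1) / 2 - (b - 1) \<notin> \<int>\<^sub>\<le>\<^sub>0" if "r \<le> i" for r
      using Suc.prems(3)[of "Suc r"] that by (simp add: field_simps)
    note IH = Suc.IH[of a "b - 1", unfolded c e, OF _ b1 this]
    have eqs: "(a + of_nat i + of_nat r + 1) / 2 - (b - 1) = (a + of_nat (Suc i) + of_nat (Suc r) + 1) / 2 - b"
       "(a - of_nat i + of_nat r + 1) / 2 = (a - of_nat (Suc i) + of_nat (Suc r) + 1) / 2"
       "b - 1 - of_nat i = b - of_nat (Suc i)"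
       "1 + a - 2 * (b - 1) + of_nat i = c - b + 1" for r
      by (simp_all add: c_def field_simps)
    have sgn: "(\<Sum>r\<le>i. of_nat (i choose r) * h (Suc r)) =
       - (\<Sum>r\<le>i. of_nat (i choose r) * ((-1) ^ r * (Gamma ((a + of_nat (Suc i) + of_nat (Suc r) + 1) / 2 - b) *
          rGamma ((a - of_nat (Suc i) + of_nat (Suc r) + 1) / 2))))"
      unfolding h_def by (simp add: sum_negf)
    have "(c - b) * hyp_sum a (b - 1) c = 2 * 2 powr (of_nat (Suc i) - 2 * b) * (Gamma (b - of_nat (Suc i)) * rGamma (b - 1)) *
       ((c - b) * rGamma (c - b + 1)) * - (\<Sum>r\<le>i. of_nat (i choose r) * h (Suc r))"
      unfolding sgn minus_minus
      using IH[OF summable_hyp_term_lower_right[OF s]] unfolding eqs by (simp only: mult_ac)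
    then show ?thesis
      unfolding rGamma_plus1 K_def by (simp only: mult_ac mult_minus_right mult_minus_left)
  qed
  have "2 * (b - 1) * hyp_sum a b c = 2 * K * rGamma (b - 1) *
     ((\<Sum>r\<le>i. of_nat (i choose r) * h r) + (\<Sum>r\<le>i. of_nat (i choose r) * h (Suc r)))"
    unfolding hyp_sum_contiguous_plus[OF s] 1 2 by (simp only: diff_minus_eq_add distrib_left)
  also have "\<dots> = 2 * (b - 1) * (K * rGamma b * (\<Sum>r\<le>Suc i. of_nat (Suc i choose r) * h r))"
    unfolding sum_choose_Suc using rGamma_plus1[of "b - 1", symmetric] by simp
  finally have "hyp_sum a b c = K * rGamma b * (\<Sum>r\<le>Suc i. of_nat (Suc i choose r) * h r)"
    using b by simp
  also have "\<dots> = 2 powr (of_nat (Suc i) - 2 * b) * (Gamma (b - of_nat (Suc i)) * rGamma b) * rGamma (c - b) *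
       (\<Sum>r\<le>Suc i. of_nat (Suc i choose r) * h r)"
    unfolding K_def by (simp only: mult_ac)
  also have "c - b = 1 + a - 2 * b + of_nat (Suc i)"
    by (simp add: c_def)
  finally show ?case
    unfolding c_def h_def .
qed

subsection \<open>Diagonal sums\<close>

text \<open>On the diagonal m + n = N the parameters \<alpha>, \<gamma>, \<beta> contribute constant
  factors. What remains is a multiple of 2F1(-N, d-\<beta>; d; 1) = (\<beta>)_N/(d)_N by
  Chu-Vandermonde, and (\<beta>)_N cancels.\<close>

lemma kdf_diag_eq_hyp_term:
  assumes \<beta>: "\<beta> \<notin> \<int>\<^sub>\<le>\<^sub>0" and d: "d \<notin> \<int>\<^sub>\<le>\<^sub>0"
  shows "kdf_diag [\<alpha>, \<gamma>] [] [d - \<beta>] [\<beta>] [] [d] (-1) 1 N = Gamma d * hyp_term \<alpha> \<gamma> d N"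
proof -
  have nz: "pochhammer \<beta> n \<noteq> 0" "pochhammer d n \<noteq> 0" for n
    using assms by (auto simp: pochhammer_eq_0_iff)
  have "kdf_diag [\<alpha>, \<gamma>] [] [d - \<beta>] [\<beta>] [] [d] (-1) 1 N =
     (\<Sum>n=0..N. kdf_term [\<alpha>, \<gamma>] [] [d - \<beta>] [\<beta>] [] [d] (-1) 1 (N - n) n)"
    unfolding kdf_diag_def atMost_atLeast0
    by (subst sum.atLeastAtMost_rev) (rule sum.cong, simp_all)
  also have "\<dots> = (\<Sum>n=0..N. (-1) ^ N * (pochhammer \<alpha> N * pochhammer \<gamma> N / (pochhammer \<beta> N * fact N)) *
      (pochhammer (d - \<beta>) n * pochhammer (- of_nat N) n / (of_nat (fact n) * pochhammer d n)))"
  proof (rule sum.cong)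
    fix n assume "n \<in> {0..N}"
    then have n: "n \<le> N" by simp
    have "pochhammer (- of_nat N) n = (-1) ^ n * (fact N / fact (N - n) :: complex)"
    proof -
      have "pochhammer (- of_nat N) n = (-1) ^ n * fact n * (of_nat N gchoose n :: complex)"
        by (simp add: gbinomial_pochhammer)
      also have "(of_nat N gchoose n :: complex) = fact N / (fact n * fact (N - n))"
        using n by (simp add: binomial_gbinomial[symmetric] binomial_fact)
      finally show ?thesis by simp
    qed
    moreover have "(-1 :: complex) ^ N * (-1) ^ n = (-1) ^ (N - n)"
      using n by (metis (no_types) even_add le_add_diff_inverse minus_one_power_iff power_add)
    \<comment> \<open>Rewriting the sign and 1/(N-n)! through (-N)_n brings the inner sum into
      Vandermonde form.\<close>
    ultimately have p: "(-1) ^ N * pochhammer (- of_nat N) n = (-1) ^ (N - n) * (fact N / fact (N - n) :: complex)"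
      by (metis mult.assoc)
    have "(-1) ^ N * (pochhammer \<alpha> N * pochhammer \<gamma> N / (pochhammer \<beta> N * fact N)) *
      (pochhammer (d - \<beta>) n * pochhammer (- of_nat N) n / (of_nat (fact n) * pochhammer d n)) =
      ((-1) ^ N * pochhammer (- of_nat N) n) * (pochhammer \<alpha> N * pochhammer \<gamma> N / (pochhammer \<beta> N * fact N)) *
      (pochhammer (d - \<beta>) n / (of_nat (fact n) * pochhammer d n))"
      by simp
    then show "kdf_term [\<alpha>, \<gamma>] [] [d - \<beta>] [\<beta>] [] [d] (-1) 1 (N - n) n =
      (-1) ^ N * (pochhammer \<alpha> N * pochhammer \<gamma> N / (pochhammer \<beta> N * fact N)) *
      (pochhammer (d - \<beta>) n * pochhammer (- of_nat N) n / (of_nat (fact n) * pochhammer d n))"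
      unfolding p using n by (simp add: kdf_term_def field_simps)
  qed simp
  also have "\<dots> = (-1) ^ N * (pochhammer \<alpha> N * pochhammer \<gamma> N / (pochhammer \<beta> N * fact N)) *
      (pochhammer \<beta> N / pochhammer d N)"
  proof -
    have "\<forall>i\<in>{0..<N}. d \<noteq> - of_nat i" using d by auto
    from Vandermonde_pochhammer[OF this, of "d - \<beta>"] show ?thesis
      by (simp only: sum_distrib_left[symmetric] diff_diff_eq2 add_diff_cancel_left' diff_add_cancel)
  qed
  also have "\<dots> = (-1) ^ N * (pochhammer \<alpha> N * pochhammer \<gamma> N / fact N) / pochhammer d N"
    using nz by simp
  also have "\<dots> = Gamma d * hyp_term \<alpha> \<gamma> d N"
  proof -
    have "Gamma d * rGamma (d + of_nat N) = 1 / pochhammer d N"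
      using d by (simp add: pochhammer_Gamma rGamma_inverse_Gamma field_simps)
    then have "(-1) ^ N * (pochhammer \<alpha> N * pochhammer \<gamma> N / fact N) / pochhammer d N =
        (-1) ^ N * (pochhammer \<alpha> N * pochhammer \<gamma> N / fact N) * (Gamma d * rGamma (d + of_nat N))"
      by simp
    then show ?thesis by (simp only: hyp_term_def mult_ac)
  qed
  finally show ?thesis .
qed

text \<open>Gamma d is nonzero away from its poles, so convergence along the diagonals passes to the
  single series.\<close>

lemma KdF_eq_hyp_sum:
  assumes "\<beta> \<notin> \<int>\<^sub>\<le>\<^sub>0" "d \<notin> \<int>\<^sub>\<le>\<^sub>0"
    and "kdf_converges [\<alpha>, \<gamma>] [] [d - \<beta>] [\<beta>] [] [d] (-1) 1"
  shows "summable (hyp_term \<alpha> \<gamma> d)"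
    and "KdF [\<alpha>, \<gamma>] [] [d - \<beta>] [\<beta>] [] [d] (-1) 1 = Gamma d * hyp_sum \<alpha> \<gamma> d"
proof -
  have eq: "kdf_diag [\<alpha>, \<gamma>] [] [d - \<beta>] [\<beta>] [] [d] (-1) 1 = (\<lambda>N. Gamma d * hyp_term \<alpha> \<gamma> d N)"
    using kdf_diag_eq_hyp_term[OF assms(1,2)] by blast
  show s: "summable (hyp_term \<alpha> \<gamma> d)"
    using assms(2,3) unfolding kdf_converges_def eq
    by (simp add: Gamma_eq_zero_iff)
  show "KdF [\<alpha>, \<gamma>] [] [d - \<beta>] [\<beta>] [] [d] (-1) 1 = Gamma d * hyp_sum \<alpha> \<gamma> d"
    unfolding KdF_def eq hyp_sum_def by (rule suminf_mult[OF s])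
qed

theorem theorem11:
  fixes i :: nat and \<alpha> \<beta> \<gamma> :: complex
  shows
  "(kdf_converges [\<alpha>, \<gamma>] [] [\<alpha> - \<beta> - \<gamma> + 1 + of_nat i] [\<beta>] [] [\<alpha> - \<gamma> + 1 + of_nat i] (-1) 1 \<and>
    \<beta> \<notin> \<int>\<^sub>\<le>\<^sub>0 \<and> \<alpha> - \<gamma> + 1 + of_nat i \<notin> \<int>\<^sub>\<le>\<^sub>0 \<and>
    1 + \<alpha> - \<gamma> + of_nat i \<notin> \<int>\<^sub>\<le>\<^sub>0 \<and> \<gamma> - of_nat i \<notin> \<int>\<^sub>\<le>\<^sub>0 \<and> \<gamma> \<notin> \<int>\<^sub>\<le>\<^sub>0 \<and>
    1 + \<alpha> - 2 * \<gamma> + of_nat i \<notin> \<int>\<^sub>\<le>\<^sub>0 \<and>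
    (\<forall>r\<le>i. (\<alpha> + of_nat i + of_nat r + 1) / 2 - \<gamma> \<notin> \<int>\<^sub>\<le>\<^sub>0 \<and>
             (\<alpha> - of_nat i + of_nat r + 1) / 2 \<notin> \<int>\<^sub>\<le>\<^sub>0)
   \<longrightarrow>
    KdF [\<alpha>, \<gamma>] [] [\<alpha> - \<beta> - \<gamma> + 1 + of_nat i] [\<beta>] [] [\<alpha> - \<gamma> + 1 + of_nat i] (-1) 1 =
    (2 powr (of_nat i - 2 * \<gamma>) * Gamma (1 + \<alpha> - \<gamma> + of_nat i) * Gamma (\<gamma> - of_nat i)) /
      (Gamma \<gamma> * Gamma (1 + \<alpha> - 2 * \<gamma> + of_nat i)) *
    (\<Sum>r = 0..i. (-1) ^ r * of_nat (i choose r) *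
        Gamma ((\<alpha> + of_nat i + of_nat r + 1) / 2 - \<gamma>) /
        Gamma ((\<alpha> - of_nat i + of_nat r + 1) / 2)))
  \<and>
   (kdf_converges [\<alpha>, \<gamma>] [] [\<alpha> - \<beta> - \<gamma> + 1 - of_nat i] [\<beta>] [] [\<alpha> - \<gamma> + 1 - of_nat i] (-1) 1 \<and>
    \<beta> \<notin> \<int>\<^sub>\<le>\<^sub>0 \<and> \<alpha> - \<gamma> + 1 - of_nat i \<notin> \<int>\<^sub>\<le>\<^sub>0 \<and>
    1 + \<alpha> - \<gamma> - of_nat i \<notin> \<int>\<^sub>\<le>\<^sub>0 \<and>
    1 + \<alpha> - 2 * \<gamma> - of_nat i \<notin> \<int>\<^sub>\<le>\<^sub>0 \<and>
    (\<forall>r\<le>i. (\<alpha> - of_nat i + of_nat r + 1) / 2 - \<gamma> \<notin> \<int>\<^sub>\<le>\<^sub>0 \<and>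
             (\<alpha> - of_nat i + of_nat r + 1) / 2 \<notin> \<int>\<^sub>\<le>\<^sub>0)
   \<longrightarrow>
    KdF [\<alpha>, \<gamma>] [] [\<alpha> - \<beta> - \<gamma> + 1 - of_nat i] [\<beta>] [] [\<alpha> - \<gamma> + 1 - of_nat i] (-1) 1 =
    (2 powr (- of_nat i - 2 * \<gamma>) * Gamma (1 + \<alpha> - \<gamma> - of_nat i)) /
      Gamma (1 + \<alpha> - 2 * \<gamma> - of_nat i) *
    (\<Sum>r = 0..i. of_nat (i choose r) *
        Gamma ((\<alpha> - of_nat i + of_nat r + 1) / 2 - \<gamma>) /
        Gamma ((\<alpha> - of_nat i + of_nat r + 1) / 2)))"
proof (intro conjI impI, goal_cases)
  case 1
  define d where "d = 1 + \<alpha> - \<gamma> + of_nat i"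
  \<comment> \<open>The two parameters attached to n alone differ by \<beta>, exactly the shape that
    the diagonal reduction requires.\<close>
  have d: "\<alpha> - \<beta> - \<gamma> + 1 + of_nat i = d - \<beta>" "\<alpha> - \<gamma> + 1 + of_nat i = d"
    by (simp_all add: d_def)
  note prems = 1[unfolded d]
  have K: "summable (hyp_term \<alpha> \<gamma> d)"
    "KdF [\<alpha>, \<gamma>] [] [d - \<beta>] [\<beta>] [] [d] (-1) 1 = Gamma d * hyp_sum \<alpha> \<gamma> d"
    using prems by (blast intro: KdF_eq_hyp_sum)+
  have "hyp_sum \<alpha> \<gamma> d =
    2 powr (of_nat i - 2 * \<gamma>) * (Gamma (\<gamma> - of_nat i) * rGamma \<gamma>) * rGamma (1 + \<alpha> - 2 * \<gamma> + of_nat i) *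
    (\<Sum>r\<le>i. of_nat (i choose r) * ((-1) ^ r *
       (Gamma ((\<alpha> + of_nat i + of_nat r + 1) / 2 - \<gamma>) * rGamma ((\<alpha> - of_nat i + of_nat r + 1) / 2))))"
    unfolding d_def
    by (rule generalized_kummer_plus) (use prems K(1) in \<open>unfold d_def, blast+\<close>)
  then show ?case
    unfolding d K(2) d_def[symmetric] atMost_atLeast0
    by (simp only: rGamma_inverse_Gamma divide_inverse inverse_mult_distrib mult_ac)
next
  case 2
  define d where "d = 1 + \<alpha> - \<gamma> - of_nat i"
  have d: "\<alpha> - \<beta> - \<gamma> + 1 - of_nat i = d - \<beta>" "\<alpha> - \<gamma> + 1 - of_nat i = d"
    by (simp_all add: d_def)
  note prems = 2[unfolded d]
  have K: "summable (hyp_term \<alpha> \<gamma> d)"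
    "KdF [\<alpha>, \<gamma>] [] [d - \<beta>] [\<beta>] [] [d] (-1) 1 = Gamma d * hyp_sum \<alpha> \<gamma> d"
    using prems by (blast intro: KdF_eq_hyp_sum)+
  have "hyp_sum \<alpha> \<gamma> d =
    2 powr (- of_nat i - 2 * \<gamma>) * rGamma (1 + \<alpha> - 2 * \<gamma> - of_nat i) *
    (\<Sum>r\<le>i. of_nat (i choose r) *
       (Gamma ((\<alpha> - of_nat i + of_nat r + 1) / 2 - \<gamma>) * rGamma ((\<alpha> - of_nat i + of_nat r + 1) / 2)))"
    unfolding d_def
    by (rule generalized_kummer_minus) (use prems K(1) in \<open>unfold d_def, blast+\<close>)
  then show ?case
    unfolding d K(2) d_def[symmetric] atMost_atLeast0
    by (simp only: rGamma_inverse_Gamma divide_inverse inverse_mult_distrib mult_ac)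
qed

end
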